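(* Let $T$ be a rooted, countably infinite and locally finite tree. Assume that $T$ is homogeneous by sectors at the level $N$, with $N\ge 1$. Let $B:\mathcal{L}\to\mathcal{L}$ be the backward shift. Then $\|B\|\ge\max\{2\gamma(o),\,3\Gamma'-2\}$, where $\Gamma'=\max\{\gamma(v): 0<|v|\le N\}$.
   Context: A tree is an undirected graph (no loops or multiple edges) in which any two vertices are joined by exactly one path; $T$ also denotes its vertex set. It is locally finite if every vertex has finite degree. $T$ has a distinguished vertex $o$, the root; $|v|$ is the length (number of edges) of the path from $o$ to $v$. For $v\neq o$, the parent $\mathrm{par}(v)$ is the vertex preceding $v$ on the unique path from $o$ to $v$; $\mathrm{Chi}(v)$ is the set of children of $v$ (vertices with parent $v$), and $\gamma(v)$ is its cardinality. The sector $S_v$ is the set consisting of $v$ and all its descendants. $T$ is homogeneous by sectors at the level $N$ if for all $v\in T$ with $|v|=N$ we have $\gamma(w)=\gamma(v)$ for each $w\in S_v$. For $f:T\to\mathbb{C}$ define $f'(o)=f(o)$ and $f'(v)=f(v)-f(\mathrm{par}(v))$ for $v\neq o$. The Lipschitz space $\mathcal{L}$ is the Banach space of all $f:T\to\mathbb{C}$ with $f'$ bounded, with norm $\|f\|=\sup_{v\in T}|f'(v)|$. The backward shift is $(Bf)(v)=\sum_{w\in\mathrm{Chi}(v)}f(w)$ (empty sum equal to $0$); it is bounded on $\mathcal{L}$ when $T$ is homogeneous by sectors. *)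

theory Defs
  imports "HOL-Analysis.Analysis"
begin

locale simple_graph =
  fixes V :: "'a set" and adj :: "'a \<Rightarrow> 'a \<Rightarrow> bool"
  assumes adj_in_V: "adj u v \<Longrightarrow> u \<in> V \<and> v \<in> V"
    and adj_sym: "adj u v \<Longrightarrow> adj v u"
    and adj_irrefl: "\<not> adj v v"
begin

text \<open>A path is represented by its list of (pairwise distinct) vertices.\<close>

definition is_path :: "'a \<Rightarrow> 'a \<Rightarrow> 'a list \<Rightarrow> bool" where
  "is_path u v p \<longleftrightarrow>
     p \<noteq> [] \<and> set p \<subseteq> V \<and> distinct p \<and> successively adj p \<and> hd p = u \<and> last p = v"

definition locally_finite :: bool where
  "locally_finite \<longleftrightarrow> (\<forall>v\<in>V. finite {w \<in> V. adj v w})"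

end

locale rooted_tree = simple_graph V adj
  for V :: "'a set" and adj :: "'a \<Rightarrow> 'a \<Rightarrow> bool" +
  fixes root :: 'a
  assumes unique_path: "u \<in> V \<Longrightarrow> v \<in> V \<Longrightarrow> \<exists>!p. is_path u v p"
    and root_in_V: "root \<in> V"
begin

definition root_path :: "'a \<Rightarrow> 'a list" where
  "root_path v = (THE p. is_path root v p)"

definition level :: "'a \<Rightarrow> nat" where
  "level v = length (root_path v) - 1"

text \<open>Meaningful only for non-root vertices, whose root path has at least two entries.\<close>

definition par :: "'a \<Rightarrow> 'a" where
  "par v = last (butlast (root_path v))"

definition Chi :: "'a \<Rightarrow> 'a set" where
  "Chi v = {w \<in> V. w \<noteq> root \<and> par w = v}"

definition gam :: "'a \<Rightarrow> nat" where
  "gam v = card (Chi v)"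

definition sector :: "'a \<Rightarrow> 'a set" where
  "sector v = {w. (v, w) \<in> {(x, y). y \<in> Chi x}\<^sup>*}"

definition homogeneous_by_sectors :: "nat \<Rightarrow> bool" where
  "homogeneous_by_sectors N \<longleftrightarrow>
     (\<forall>v\<in>V. level v = N \<longrightarrow> (\<forall>w\<in>sector v. gam w = gam v))"

definition tderiv :: "('a \<Rightarrow> complex) \<Rightarrow> 'a \<Rightarrow> complex" where
  "tderiv f v = (if v = root then f root else f v - f (par v))"

text \<open>Functions on the vertex set are extensional, i.e. fixed to be undefined off \<open>V\<close>,
  so that \<open>lip_norm\<close> is a norm and not merely a seminorm.\<close>

definition lipschitz_space :: "('a \<Rightarrow> complex) set" where
  "lipschitz_space = {f \<in> extensional V. bounded (tderiv f ` V)}"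

definition lip_norm :: "('a \<Rightarrow> complex) \<Rightarrow> real" where
  "lip_norm f = (SUP v\<in>V. cmod (tderiv f v))"

definition backward_shift :: "('a \<Rightarrow> complex) \<Rightarrow> 'a \<Rightarrow> complex" where
  "backward_shift f = (\<lambda>v\<in>V. \<Sum>w\<in>Chi v. f w)"

text \<open>The operator norm of an operator on \<open>lipschitz_space\<close>.  The suprema here and in
  \<open>lip_norm\<close> are real-valued, so they carry their usual meaning only for bounded operators
  (resp. for members of \<open>lipschitz_space\<close>); the backward shift is bounded on trees that are
  locally finite and homogeneous by sectors.\<close>

definition op_norm :: "(('a \<Rightarrow> complex) \<Rightarrow> ('a \<Rightarrow> complex)) \<Rightarrow> real" where
  "op_norm A = (SUP f\<in>{f \<in> lipschitz_space. lip_norm f \<le> 1}. lip_norm (A f))"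

end

end

theory Submission
  imports Defs
begin

text \<open>
  A function on the tree is the sum of its derivative along root paths, so every assignment of
  numbers of modulus at most one to the vertices is the derivative of a function in the closed
  unit ball of the Lipschitz space.  Two such assignments yield the two lower bounds.

  If the derivative is constantly one, every child of the root has value two, which gives
  \<open>2 \<gamma>(o)\<close> for \<open>B f\<close> at the root.  For a vertex \<open>v \<noteq> o\<close> with parent \<open>u\<close>, let the derivative be
  one at the root, at \<open>v\<close> and at the children of \<open>v\<close>, minus one at the siblings of \<open>v\<close>, and zero
  elsewhere.  Then \<open>f\<close> is one at \<open>u\<close>, two at \<open>v\<close>, three at the children of \<open>v\<close> and zero at the
  siblings, so that \<open>(B f)(v) - (B f)(u) = 3 \<gamma>(v) - 2\<close>.  The siblings contribute nothing,
  whence the independence of \<open>\<gamma>(u)\<close>.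

  A real supremum dominates its members only if it is taken over a bounded set, so the argument
  also needs that \<open>B\<close> is bounded; this is where homogeneity enters.  The degrees take only
  finitely many values, as each one beyond level \<open>N\<close> occurs already at level \<open>N\<close>.  Down to level
  \<open>N\<close> the estimate \<open>cmod (f v) \<le> level v + 1\<close> suffices.  Further down, \<open>v\<close> and its parent \<open>u\<close>
  have the same number \<open>g\<close> of children, and both \<open>(B f)(v) - g f(v)\<close> and \<open>(B f)(u) - g f(u)\<close> are
  sums of \<open>g\<close> derivatives, which makes \<open>(B f)'(v)\<close> at most \<open>3 g\<close> in modulus.
\<close>

context rooted_tree
begin

section \<open>Root paths, levels and children\<close>

lemma is_path_root_path: "v \<in> V \<Longrightarrow> is_path root v (root_path v)"
  unfolding root_path_def by (rule theI') (rule unique_path[OF root_in_V])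

lemma root_path_eqI:
  assumes "is_path root v p"
  shows "root_path v = p"
proof -
  have "v \<in> V"
    using assms unfolding is_path_def by (metis last_in_set subsetD)
  with assms is_path_root_path unique_path[OF root_in_V] show ?thesis
    by blast
qed

lemma root_path_root: "root_path root = [root]"
  by (rule root_path_eqI) (simp add: is_path_def root_in_V)

text \<open>Cutting off the last vertex of a root path leaves a path, which uniqueness identifies with
  the root path of the parent.\<close>

lemma root_path_nonroot:
  assumes v: "v \<in> V" "v \<noteq> root"
  shows par_in_V: "par v \<in> V"
    and adj_par: "adj (par v) v"
    and root_path_par: "root_path v = root_path (par v) @ [v]"
proof -
  let ?q = "butlast (root_path v)"
  have p: "is_path root v (root_path v)"
    using v(1) by (rule is_path_root_path)
  then have p_eq: "root_path v = ?q @ [v]"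
    by (metis append_butlast_last_id is_path_def)
  have "?q \<noteq> []"
  proof
    assume "?q = []"
    then have "root_path v = [v]"
      using p_eq by simp
    then show False
      using p v(2) by (simp add: is_path_def)
  qed
  moreover have "distinct (?q @ [v])" "successively adj (?q @ [v])" "hd (?q @ [v]) = root"
      "set (?q @ [v]) \<subseteq> V"
    using p p_eq unfolding is_path_def by metis+
  ultimately have q: "is_path root (par v) ?q" and adj: "adj (par v) v"
    unfolding is_path_def par_def by (auto simp: successively_append_iff)
  show "adj (par v) v"
    by (rule adj)
  then show "par v \<in> V"
    using adj_in_V by blast
  show "root_path v = root_path (par v) @ [v]"
    using p_eq root_path_eqI[OF q] by simp
qed

lemma level_root: "level root = 0"
  by (simp add: level_def root_path_root)

lemma level_par:
  assumes "v \<in> V" "v \<noteq> root"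
  shows "level v = Suc (level (par v))"
proof -
  have "root_path (par v) \<noteq> []"
    using is_path_root_path[OF par_in_V[OF assms]] by (simp add: is_path_def)
  then show ?thesis
    using root_path_par[OF assms] by (simp add: level_def)
qed

lemma vertex_induct [consumes 1, case_names root par]:
  assumes "v \<in> V"
    and "P root"
    and step: "\<And>v. v \<in> V \<Longrightarrow> v \<noteq> root \<Longrightarrow> P (par v) \<Longrightarrow> P v"
  shows "P v"
  using assms(1)
proof (induction "level v" arbitrary: v rule: less_induct)
  case less
  show ?case
  proof (cases "v = root")
    case False
    with less.prems have "P (par v)"
      by (intro less.hyps) (simp_all add: level_par par_in_V)
    with less.prems False show ?thesis
      by (rule step)
  qed (simp add: assms(2))
qed

lemma level_eq_0_iff: "v \<in> V \<Longrightarrow> level v = 0 \<longleftrightarrow> v = root"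
  using level_root level_par by fastforce

lemma Chi_D:
  assumes "w \<in> Chi v"
  shows "w \<in> V" "w \<noteq> root" "par w = v" "level w = Suc (level v)"
  using assms level_par unfolding Chi_def by auto

lemma mem_Chi_par: "v \<in> V \<Longrightarrow> v \<noteq> root \<Longrightarrow> v \<in> Chi (par v)"
  by (simp add: Chi_def)

lemma finite_Chi:
  assumes "locally_finite" "v \<in> V"
  shows "finite (Chi v)"
proof (rule finite_subset)
  show "Chi v \<subseteq> {w \<in> V. adj v w}"
    using adj_par by (auto simp: Chi_def)
  show "finite {w \<in> V. adj v w}"
    using assms by (simp add: locally_finite_def)
qed

lemma finite_level_le:
  assumes "locally_finite"
  shows "finite {v \<in> V. level v \<le> n}"
proof (induction n)
  case 0
  have "{v \<in> V. level v \<le> 0} \<subseteq> {root}"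
    using level_eq_0_iff by auto
  then show ?case
    by (rule finite_subset) simp
next
  case (Suc n)
  have "{v \<in> V. level v \<le> Suc n} \<subseteq> insert root (\<Union>(Chi ` {v \<in> V. level v \<le> n}))"
  proof
    fix v
    assume v: "v \<in> {v \<in> V. level v \<le> Suc n}"
    show "v \<in> insert root (\<Union>(Chi ` {v \<in> V. level v \<le> n}))"
    proof (cases "v = root")
      case False
      with v have "v \<in> Chi (par v)" "par v \<in> V" "level (par v) \<le> n"
        using mem_Chi_par par_in_V level_par by fastforce+
      then show ?thesis
        by blast
    qed simp
  qed
  moreover have "finite (insert root (\<Union>(Chi ` {v \<in> V. level v \<le> n})))"
    using Suc.IH finite_Chi[OF assms] by auto
  ultimately show ?case
    by (rule finite_subset)
qed

lemma exists_level_1: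
  assumes "infinite V"
  shows "\<exists>v\<in>V. level v = 1"
proof -
  have "V \<noteq> {root}"
    using assms by auto
  then obtain v where v: "v \<in> V" "v \<noteq> root"
    using root_in_V by blast
  have "v \<noteq> root \<longrightarrow> (\<exists>x\<in>V. level x = 1)"
    using v(1)
  proof (induction rule: vertex_induct)
    case (par v)
    then show ?case
      using level_par[OF par.hyps] level_root by (cases "par v = root") auto
  qed simp
  with v(2) show ?thesis
    by blast
qed

section \<open>Homogeneity bounds the degrees\<close>

text \<open>Homogeneity speaks of sectors only; this lets it be applied at every vertex whose level is
  at least \<open>N\<close>.\<close>

lemma exists_sector_at_level:
  assumes "v \<in> V" "N \<le> level v"
  shows "\<exists>u\<in>V. level u = N \<and> v \<in> sector u"
proof -
  have self: "x \<in> sector x" for x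
    by (simp add: sector_def)
  have "N \<le> level v \<longrightarrow> (\<exists>u\<in>V. level u = N \<and> v \<in> sector u)"
    using assms(1)
  proof (induction rule: vertex_induct)
    case root
    show ?case
      using self root_in_V level_root by auto
  next
    case (par v)
    show ?case
    proof (intro impI, cases "level v = N")
      case True
      then show "\<exists>u\<in>V. level u = N \<and> v \<in> sector u"
        using self par.hyps by blast
    next
      case False
      assume "N \<le> level v"
      with False have "N \<le> level (par v)"
        using level_par[OF par.hyps] by simp
      then obtain u where u: "u \<in> V" "level u = N" "par v \<in> sector u"
        using par.IH by blast
      have "v \<in> sector u"
        using u(3) mem_Chi_par[OF par.hyps] unfolding sector_def
        by (auto intro: rtrancl_into_rtrancl)
      with u show "\<exists>u\<in>V. level u = N \<and> v \<in> sector u"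
        by blast
    qed
  qed
  with assms(2) show ?thesis
    by blast
qed

lemma gam_bounded:
  assumes "locally_finite" "homogeneous_by_sectors N"
  obtains M where "\<And>v. v \<in> V \<Longrightarrow> gam v \<le> M"
proof
  let ?S = "gam ` {v \<in> V. level v \<le> N}"
  fix v
  assume v: "v \<in> V"
  have "gam v \<in> ?S"
  proof (cases "level v \<le> N")
    case False
    then obtain u where "u \<in> V" "level u = N" "v \<in> sector u"
      using exists_sector_at_level[OF v, of N] by auto
    with assms(2) have "u \<in> V" "level u \<le> N" "gam v = gam u"
      by (auto simp: homogeneous_by_sectors_def)
    then show ?thesis
      by blast
  qed (use v in auto)
  then show "gam v \<le> Max ?S"
    using finite_level_le[OF assms(1)] by (intro Max_ge) auto
qed

lemma gam_par:
  assumes hom: "homogeneous_by_sectors N" and v: "v \<in> V" "N < level v"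
  shows "gam (par v) = gam v"
proof -
  have nr: "v \<noteq> root"
    using v(2) level_root by auto
  then have "N \<le> level (par v)"
    using v level_par by fastforce
  then obtain u where u: "u \<in> V" "level u = N" "par v \<in> sector u"
    using exists_sector_at_level[OF par_in_V[OF v(1) nr]] by blast
  have "v \<in> sector u"
    using u(3) mem_Chi_par[OF v(1) nr] unfolding sector_def
    by (auto intro: rtrancl_into_rtrancl)
  with u hom show ?thesis
    by (auto simp: homogeneous_by_sectors_def)
qed

section \<open>The unit ball of the Lipschitz space\<close>

lemma lip_norm_ge:
  assumes "bounded (tderiv f ` V)" "v \<in> V"
  shows "cmod (tderiv f v) \<le> lip_norm f"
proof -
  have "bdd_above ((\<lambda>v. cmod (tderiv f v)) ` V)"
    using assms(1) by (auto simp: bounded_iff bdd_above_def)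
  then show ?thesis
    unfolding lip_norm_def by (rule cSUP_upper2[OF _ assms(2) order_refl])
qed

lemma lip_norm_le:
  assumes "\<And>v. v \<in> V \<Longrightarrow> cmod (tderiv f v) \<le> C"
  shows "lip_norm f \<le> C"
  unfolding lip_norm_def using root_in_V assms by (intro cSUP_least) auto

lemma unit_ball_tderiv:
  assumes "f \<in> lipschitz_space" "lip_norm f \<le> 1" "v \<in> V"
  shows "cmod (tderiv f v) \<le> 1"
  using lip_norm_ge[OF _ assms(3), of f] assms(1,2) by (simp add: lipschitz_space_def)

definition primitive :: "('a \<Rightarrow> complex) \<Rightarrow> 'a \<Rightarrow> complex" where
  "primitive d = (\<lambda>v\<in>V. \<Sum>x\<leftarrow>root_path v. d x)"

lemma primitive_root: "primitive d root = d root"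
  by (simp add: primitive_def root_in_V root_path_root)

lemma primitive_par:
  "v \<in> V \<Longrightarrow> v \<noteq> root \<Longrightarrow> primitive d v = primitive d (par v) + d v"
  by (simp add: primitive_def par_in_V root_path_par)

lemma tderiv_primitive: "v \<in> V \<Longrightarrow> tderiv (primitive d) v = d v"
  by (simp add: tderiv_def primitive_root primitive_par)

lemma primitive_unit_ball:
  assumes "\<And>v. v \<in> V \<Longrightarrow> cmod (d v) \<le> 1"
  shows "primitive d \<in> lipschitz_space" "lip_norm (primitive d) \<le> 1"
proof -
  have le: "cmod (tderiv (primitive d) v) \<le> 1" if "v \<in> V" for v
    using assms that by (simp add: tderiv_primitive)
  then show "lip_norm (primitive d) \<le> 1"
    by (rule lip_norm_le)
  have "primitive d \<in> extensional V"
    by (simp add: primitive_def)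
  with le show "primitive d \<in> lipschitz_space"
    by (auto simp: lipschitz_space_def bounded_iff)
qed

lemma cmod_le_level:
  assumes "\<And>v. v \<in> V \<Longrightarrow> cmod (tderiv f v) \<le> 1" "v \<in> V"
  shows "cmod (f v) \<le> real (level v) + 1"
  using assms(2)
proof (induction rule: vertex_induct)
  case root
  show ?case
    using assms(1)[OF root_in_V] by (simp add: tderiv_def level_root)
next
  case (par v)
  have "cmod (f v) \<le> cmod (f (par v)) + cmod (f v - f (par v))"
    by (rule norm_triangle_sub)
  also have "\<dots> \<le> (real (level (par v)) + 1) + 1"
    using par assms(1)[of v] by (intro add_mono) (auto simp: tderiv_def)
  also have "\<dots> = real (level v) + 1"
    using level_par[OF par.hyps] by simp
  finally show ?case .
qed

section \<open>Boundedness of the backward shift\<close>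

lemma cmod_backward_shift_minus:
  assumes f: "\<And>v. v \<in> V \<Longrightarrow> cmod (tderiv f v) \<le> 1" and v: "v \<in> V"
  shows "cmod (backward_shift f v - of_nat (gam v) * f v) \<le> real (gam v)"
proof -
  have "backward_shift f v - of_nat (gam v) * f v = (\<Sum>w\<in>Chi v. f w - f v)"
    using v by (simp add: backward_shift_def gam_def sum_subtractf)
  also have "\<dots> = (\<Sum>w\<in>Chi v. tderiv f w)"
    by (rule sum.cong) (auto simp: tderiv_def dest: Chi_D)
  also have "cmod \<dots> \<le> (\<Sum>w\<in>Chi v. 1)"
    using f by (intro sum_norm_le) (auto dest: Chi_D)
  finally show ?thesis
    by (simp add: gam_def)
qed

lemma cmod_backward_shift_le:
  assumes f: "\<And>v. v \<in> V \<Longrightarrow> cmod (tderiv f v) \<le> 1" and v: "v \<in> V"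
  shows "cmod (backward_shift f v) \<le> real (gam v) * (real (level v) + 2)"
proof -
  have "cmod (f w) \<le> real (level v) + 2" if "w \<in> Chi v" for w
    using cmod_le_level[of f w] f Chi_D[OF that] by simp
  then have "cmod (\<Sum>w\<in>Chi v. f w) \<le> (\<Sum>w\<in>Chi v. real (level v) + 2)"
    by (intro sum_norm_le) auto
  then show ?thesis
    using v by (simp add: backward_shift_def gam_def)
qed

text \<open>The values of \<open>f\<close> grow with the level, so a bound uniform in the level requires the
  leading terms \<open>\<gamma>(v) f(v)\<close> and \<open>\<gamma>(u) f(u)\<close>, with \<open>u\<close> the parent of \<open>v\<close>, to cancel up to a
  multiple of \<open>f(v) - f(u)\<close>.\<close>

lemma tderiv_backward_shift_equal_gam:
  assumes f: "\<And>v. v \<in> V \<Longrightarrow> cmod (tderiv f v) \<le> 1"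
    and v: "v \<in> V" "v \<noteq> root" and eq: "gam (par v) = gam v"
  shows "cmod (tderiv (backward_shift f) v) \<le> 3 * real (gam v)"
proof -
  let ?u = "par v" and ?g = "of_nat (gam v) :: complex"
  have u: "?u \<in> V"
    using v by (rule par_in_V)
  have 1: "cmod (backward_shift f v - ?g * f v) \<le> real (gam v)"
    using cmod_backward_shift_minus[OF f v(1)] .
  have 2: "cmod (backward_shift f ?u - ?g * f ?u) \<le> real (gam v)"
    using cmod_backward_shift_minus[OF f u] eq by simp
  have 3: "cmod (?g * tderiv f v) \<le> real (gam v)"
    using mult_left_mono[OF f[OF v(1)], of "real (gam v)"] by (simp add: norm_mult)
  have "tderiv (backward_shift f) v = (backward_shift f v - ?g * f v) + ?g * tderiv f v
      - (backward_shift f ?u - ?g * f ?u)"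
    using v by (simp add: tderiv_def algebra_simps)
  also have "cmod \<dots> \<le> cmod (backward_shift f v - ?g * f v) + cmod (?g * tderiv f v)
      + cmod (backward_shift f ?u - ?g * f ?u)"
    using norm_triangle_ineq4 norm_triangle_ineq by (meson add_right_mono order_trans)
  also have "\<dots> \<le> 3 * real (gam v)"
    using 1 2 3 by linarith
  finally show ?thesis .
qed

lemma backward_shift_bounded:
  assumes lf: "locally_finite" and hom: "homogeneous_by_sectors N"
  obtains C where "\<And>f v. f \<in> lipschitz_space \<Longrightarrow> lip_norm f \<le> 1 \<Longrightarrow> v \<in> V \<Longrightarrow>
      cmod (tderiv (backward_shift f) v) \<le> C"
proof -
  obtain M where M: "\<And>v. v \<in> V \<Longrightarrow> gam v \<le> M"
    using gam_bounded[OF lf hom] by blast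
  show thesis
  proof
    fix f v
    assume "f \<in> lipschitz_space" "lip_norm f \<le> 1" and v: "v \<in> V"
    then have f: "\<And>v. v \<in> V \<Longrightarrow> cmod (tderiv f v) \<le> 1"
      by (blast intro: unit_ball_tderiv)
    have shallow: "cmod (backward_shift f x) \<le> real M * (real N + 2)"
      if "x \<in> V" "level x \<le> N" for x
    proof -
      have "real (gam x) * (real (level x) + 2) \<le> real M * (real N + 2)"
        using that M[of x] by (intro mult_mono) auto
      then show ?thesis
        using cmod_backward_shift_le[OF f that(1)] by linarith
    qed
    have nonneg: "0 \<le> real M * (real N + 2)"
      by simp
    show "cmod (tderiv (backward_shift f) v) \<le> 2 * (real M * (real N + 2)) + 3 * real M"
    proof (cases "level v \<le> N")
      case True
      show ?thesis
      proof (cases "v = root")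
        case True
        then show ?thesis
          using shallow[OF v \<open>level v \<le> N\<close>] nonneg
          unfolding tderiv_def if_P[OF True] by (simp only: True)
      next
        case False
        have "cmod (backward_shift f (par v)) \<le> real M * (real N + 2)"
          using True level_par[OF v False] by (intro shallow par_in_V v False) simp
        moreover have "cmod (tderiv (backward_shift f) v)
            \<le> cmod (backward_shift f v) + cmod (backward_shift f (par v))"
          using False by (simp add: tderiv_def norm_triangle_ineq4)
        ultimately show ?thesis
          using shallow[OF v True] by linarith
      qed
    next
      case False
      then have "v \<noteq> root"
        using level_root by auto
      moreover have "gam (par v) = gam v"
        using False by (intro gam_par[OF hom v]) simp
      ultimately have "cmod (tderiv (backward_shift f) v) \<le> 3 * real (gam v)"
        using tderiv_backward_shift_equal_gam[OF f v] by blast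
      then show ?thesis
        using M[OF v] nonneg by linarith
    qed
  qed
qed

text \<open>The derivative at a single vertex is compared with two nested real suprema.
  The uniform bound on the derivatives of \<open>B f\<close> makes both families bounded, the one over the
  vertices and the one over the unit ball.\<close>

lemma op_norm_backward_shift_ge:
  assumes lf: "locally_finite" and hom: "homogeneous_by_sectors N"
    and f: "f \<in> lipschitz_space" "lip_norm f \<le> 1" and v: "v \<in> V"
  shows "cmod (tderiv (backward_shift f) v) \<le> op_norm backward_shift"
proof -
  obtain C where C: "\<And>f v. f \<in> lipschitz_space \<Longrightarrow> lip_norm f \<le> 1 \<Longrightarrow> v \<in> V \<Longrightarrow>
      cmod (tderiv (backward_shift f) v) \<le> C"
    using backward_shift_bounded[OF lf hom] by blast
  have "bounded (tderiv (backward_shift f) ` V)"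
    using C[OF f] by (auto simp: bounded_iff)
  then have "cmod (tderiv (backward_shift f) v) \<le> lip_norm (backward_shift f)"
    using v by (rule lip_norm_ge)
  also have "\<dots> \<le> op_norm backward_shift"
    unfolding op_norm_def
  proof (rule cSUP_upper)
    show "f \<in> {f \<in> lipschitz_space. lip_norm f \<le> 1}"
      using f by simp
    show "bdd_above ((\<lambda>f. lip_norm (backward_shift f)) ` {f \<in> lipschitz_space. lip_norm f \<le> 1})"
      using C lip_norm_le by (intro bdd_aboveI2[of _ _ C]) blast
  qed
  finally show ?thesis .
qed

section \<open>Two test functions\<close>

lemma op_norm_ge_gam_root:
  assumes lf: "locally_finite" and hom: "homogeneous_by_sectors N"
  shows "2 * real (gam root) \<le> op_norm backward_shift"
proof -
  let ?f = "primitive (\<lambda>_. 1)"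
  have "?f w = 2" if "w \<in> Chi root" for w
    using Chi_D[OF that] by (simp add: primitive_par primitive_root)
  then have "tderiv (backward_shift ?f) root = of_real (2 * real (gam root))"
    by (simp add: tderiv_def backward_shift_def root_in_V gam_def)
  then have "cmod (tderiv (backward_shift ?f) root) = 2 * real (gam root)"
    by (simp only: norm_of_real)
  moreover have "cmod (tderiv (backward_shift ?f) root) \<le> op_norm backward_shift"
    using lf hom by (rule op_norm_backward_shift_ge) (simp_all add: primitive_unit_ball root_in_V)
  ultimately show ?thesis
    by simp
qed

lemma op_norm_ge_gam_nonroot:
  assumes lf: "locally_finite" and hom: "homogeneous_by_sectors N"
    and v: "v \<in> V" "v \<noteq> root"
  shows "3 * real (gam v) - 2 \<le> op_norm backward_shift"
proof -
  let ?u = "par v"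
  define d :: "'a \<Rightarrow> complex" where
    "d x = (if x = root \<or> x = v \<or> x \<in> Chi v then 1 else if x \<in> Chi ?u then -1 else 0)" for x
  let ?f = "primitive d"
  \<comment> \<open>The order of the cases in \<open>d\<close> matters: \<open>v\<close> is itself a child of \<open>?u\<close>, but must
    receive \<open>1\<close> and not \<open>-1\<close>.\<close>
  have u: "?u \<in> V"
    using v by (rule par_in_V)
  have lev: "level v = Suc (level ?u)"
    using v by (rule level_par)
  have above: "level x < level v \<longrightarrow> ?f x = 1" if "x \<in> V" for x
    using that
  proof (induction rule: vertex_induct)
    case root
    show ?case
      by (simp add: primitive_root d_def)
  next
    case (par x)
    have "d x = 0" if "level x < level v"
      using that par.hyps Chi_D(4)[of x v] Chi_D(4)[of x ?u] lev by (auto simp: d_def)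
    then show ?case
      using par level_par[OF par.hyps] by (auto simp: primitive_par)
  qed
  have fu: "?f ?u = 1"
    using above[OF u] lev by simp
  have fv: "?f v = 2"
    using v fu by (simp add: primitive_par d_def)
  have children: "?f w = 3" if "w \<in> Chi v" for w
    using Chi_D[OF that] that fv by (simp add: primitive_par d_def)
  have siblings: "?f s = 0" if "s \<in> Chi ?u - {v}" for s
  proof -
    have s: "s \<in> Chi ?u" "s \<noteq> v"
      using that by auto
    have "s \<notin> Chi v"
      using Chi_D(4)[of s v] Chi_D(4)[OF s(1)] lev by auto
    then show ?thesis
      using Chi_D[OF s(1)] s fu by (simp add: primitive_par d_def)
  qed
  have "backward_shift ?f ?u = ?f v + (\<Sum>s\<in>Chi ?u - {v}. ?f s)"
    using u finite_Chi[OF lf u] mem_Chi_par[OF v] by (simp add: backward_shift_def sum.remove)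
  then have "backward_shift ?f ?u = 2"
    using fv siblings by simp
  moreover have "backward_shift ?f v = of_nat (gam v) * 3"
    using children v by (simp add: backward_shift_def gam_def)
  ultimately have "tderiv (backward_shift ?f) v = of_real (3 * real (gam v) - 2)"
    using v by (simp add: tderiv_def)
  then have "3 * real (gam v) - 2 \<le> cmod (tderiv (backward_shift ?f) v)"
    by (simp only: norm_of_real)
  also have "\<dots> \<le> op_norm backward_shift"
    using lf hom primitive_unit_ball[of d] v(1)
    by (intro op_norm_backward_shift_ge) (auto simp: d_def)
  finally show ?thesis .
qed

end

section \<open>The lower bound\<close>

theorem proposition4p11:
  fixes V :: "'a set" and adj :: "'a \<Rightarrow> 'a \<Rightarrow> bool" and root :: 'a and N :: nat
  assumes "rooted_tree V adj root"
    and "countable V" and "infinite V"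
    and "simple_graph.locally_finite V adj"
    and "rooted_tree.homogeneous_by_sectors V adj root N"
    and "N \<ge> 1"
  shows "rooted_tree.op_norm V adj root (rooted_tree.backward_shift V adj root)
    \<ge> max (2 * real (rooted_tree.gam V adj root root))
          (3 * real (Max (rooted_tree.gam V adj root `
                 {v \<in> V. 0 < rooted_tree.level V adj root v \<and>
                          rooted_tree.level V adj root v \<le> N})) - 2)"
proof -
  interpret rooted_tree V adj root
    by (rule assms(1))
  let ?S = "{v \<in> V. 0 < level v \<and> level v \<le> N}"
  have "finite ?S"
    by (rule finite_subset[OF _ finite_level_le[OF assms(4), of N]]) auto
  moreover have "?S \<noteq> {}"
    using exists_level_1[OF assms(3)] assms(6) by force
  ultimately have "Max (gam ` ?S) \<in> gam ` ?S"
    by (intro Max_in) auto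
  then obtain v where v: "v \<in> V" "0 < level v" "Max (gam ` ?S) = gam v"
    by auto
  then have "v \<noteq> root"
    using level_root by auto
  then have "3 * real (Max (gam ` ?S)) - 2 \<le> op_norm backward_shift"
    using op_norm_ge_gam_nonroot[OF assms(4,5) v(1)] v(3) by simp
  then show ?thesis
    using op_norm_ge_gam_root[OF assms(4,5)] by simp
qed

end
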